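(* Let $H$ be a subgroup of rank $k$ in $\mathbb{Z}^{k}$. Let the columns of a $k\times k$ matrix $A$ be a $\mathbb{Z}$-basis for $H$. Then the following are equivalent. (1) $H$ is an ideal in $\mathbb{Z}^{k}$. (2) There exists a unimodular matrix $U$ such that $AU$ is a diagonal matrix. (3) There is a sequence of elementary row operations (over $\mathbb{Z}$) that can convert $A$ into a diagonal matrix.
   Context: $\mathbb{Z}^k$ is the product ring with componentwise operations; a subgroup of a ring means a subgroup of its additive group, and its rank is its rank as a free $\mathbb{Z}$-module. An integer square matrix is unimodular if it is invertible over the ring of integers (equivalently, its determinant is $1$ or $-1$). Elementary row operations over $\mathbb{Z}$ are the usual elementary row operations with the units $\pm 1$ playing the role of nonzero scalars: swapping two rows, multiplying a row by $\pm 1$, and adding an integer multiple of one row to another row.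
   Formalization: In (3) the elementary row operations are applied to the transpose of A (i.e. column operations on A), because with row operations on A itself the claim is false: A with columns (1,0), (1,2) spans the ideal Z×2Z but cannot be row-reduced to a diagonal matrix. *)

theory Defs
  imports "HOL-Analysis.Analysis" "HOL-Algebra.Ideal"
begin

text \<open>
  The ring \<open>\<int>\<^sup>k\<close> is \<open>int ^ 'k\<close> with \<open>k = CARD('k)\<close>; the type-class operations on
  this type are componentwise. They are packaged as a record so that the library notions of
  additive subgroup and ideal apply.
\<close>

definition int_power_ring :: "(int ^ 'k) ring"
  where "int_power_ring =
    \<lparr>carrier = UNIV, monoid.mult = (\<lambda>x y. x * y), one = 1, ring.zero = 0,
     add = (\<lambda>x y. x + y)\<rparr>"

lemma int_power_ring_simps:
  "carrier int_power_ring = UNIV"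
  "x \<otimes>\<^bsub>int_power_ring\<^esub> y = x * y"
  "\<one>\<^bsub>int_power_ring\<^esub> = 1"
  "\<zero>\<^bsub>int_power_ring\<^esub> = 0"
  "x \<oplus>\<^bsub>int_power_ring\<^esub> y = x + y"
  by (simp_all add: int_power_ring_def)

lemma cring_int_power_ring: "cring (int_power_ring :: (int ^ 'k) ring)"
proof (rule cringI)
  show "abelian_group (int_power_ring :: (int ^ 'k) ring)"
  proof (rule abelian_groupI)
    fix x :: "int ^ 'k"
    have "- x \<oplus>\<^bsub>int_power_ring\<^esub> x = \<zero>\<^bsub>int_power_ring\<^esub>"
      by (simp add: int_power_ring_simps)
    then show "\<exists>y \<in> carrier int_power_ring. y \<oplus>\<^bsub>int_power_ring\<^esub> x = \<zero>\<^bsub>int_power_ring\<^esub>"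
      by (auto simp: int_power_ring_simps(1))
  qed (simp_all add: int_power_ring_simps ac_simps)
  show "comm_monoid (int_power_ring :: (int ^ 'k) ring)"
    by (rule comm_monoidI) (simp_all add: int_power_ring_simps ac_simps)
qed (simp add: int_power_ring_simps algebra_simps)

text \<open>The library interprets the module \<open>int ^ 'k\<close> only for scalars in a field.\<close>

global_interpretation int_vec: module "(*s) :: int \<Rightarrow> int ^ 'k \<Rightarrow> int ^ 'k"
  by standard (simp_all add: vec_eq_iff algebra_simps)

definition has_rank :: "(int ^ 'k) set \<Rightarrow> nat \<Rightarrow> bool"
  where "has_rank H r \<longleftrightarrow>
    (\<exists>B. finite B \<and> card B = r \<and> int_vec.independent B \<and> int_vec.span B = H)"

text \<open>Injectivity makes the columns independent as a family: \<open>columns A\<close> is only their set.\<close>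

definition columns_basis :: "int ^ 'm ^ 'k \<Rightarrow> (int ^ 'k) set \<Rightarrow> bool"
  where "columns_basis A H \<longleftrightarrow>
    inj (\<lambda>j. column j A) \<and> int_vec.independent (columns A) \<and> int_vec.span (columns A) = H"

definition diagonal_matrix :: "int ^ 'k ^ 'k \<Rightarrow> bool"
  where "diagonal_matrix D \<longleftrightarrow> (\<forall>i j. i \<noteq> j \<longrightarrow> D $ i $ j = 0)"

inductive elementary_row_op :: "int ^ 'n ^ 'm \<Rightarrow> int ^ 'n ^ 'm \<Rightarrow> bool"
  where
    swap: "elementary_row_op A (\<chi> r. if r = i then A $ j else if r = j then A $ i else A $ r)"
  | scale: "c = 1 \<or> c = - 1 \<Longrightarrow> elementary_row_op A (\<chi> r. if r = i then c *s (A $ i) else A $ r)"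
  | add: "i \<noteq> j \<Longrightarrow> elementary_row_op A (\<chi> r. if r = i then A $ i + c *s (A $ j) else A $ r)"

text \<open>
  A pitfall: for a basis written in the columns of \<open>A\<close>, being an ideal does not imply that
  row operations on \<open>A\<close> itself lead to a diagonal matrix. With columns \<open>(1, 0)\<close> and
  \<open>(1, 2)\<close> one gets the ideal \<open>\<int> \<times> 2\<int>\<close>, but every matrix reachable by row
  operations keeps two columns that are congruent modulo 2 and not both even. The row operations
  have to act on the basis vectors, so they are applied to the matrix that has these as its rows,
  which is \<open>transpose A\<close>.
\<close>

lemma row_operations_on_column_basis_insufficient:
  "\<exists>(A :: int ^ 2 ^ 2) H.
     additive_subgroup H int_power_ring \<and> has_rank H CARD(2) \<and> columns_basis A H \<and>
     ideal H int_power_ring \<and>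
     \<not> (\<exists>D. elementary_row_op\<^sup>*\<^sup>* A D \<and> diagonal_matrix D)"
proof -
  define u v :: "int ^ 2" where "u = vector [1, 0]" and "v = vector [1, 2]"
  define A :: "int ^ 2 ^ 2" where "A = vector [vector [1, 1], vector [0, 2]]"
  define H where "H = {x :: int ^ 2. even (x $ 2)}"
  have uv: "u $ 1 = 1" "u $ 2 = 0" "v $ 1 = 1" "v $ 2 = 2"
    by (simp_all add: u_def v_def)
  have A: "A $ 1 $ 1 = 1" "A $ 1 $ 2 = 1" "A $ 2 $ 1 = 0" "A $ 2 $ 2 = 2"
    by (simp_all add: A_def)
  have col: "column 1 A = u" "column 2 A = v"
    by (simp_all add: column_def vec_eq_iff forall_2 A uv)
  then have cols: "columns A = {u, v}"
    by (auto simp: columns_def exhaust_2) (metis exhaust_2)+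
  have "u \<noteq> v"
    using uv by auto
  have inj: "inj (\<lambda>j. column j A)"
    using col \<open>u \<noteq> v\<close> by (auto simp: inj_def forall_2)
  have indep: "int_vec.independent {u, v}"
    using \<open>u \<noteq> v\<close> uv by (auto simp: int_vec.dependent_finite vec_eq_iff forall_2)
  have span: "int_vec.span {u, v} = H"
  proof -
    have "x \<in> H \<longleftrightarrow> (\<exists>k l. x = k *s u + l *s v)" for x
    proof
      assume "x \<in> H"
      then obtain l where "x $ 2 = 2 * l"
        by (auto simp: H_def)
      then have "x = (x $ 1 - l) *s u + l *s v"
        by (simp add: vec_eq_iff forall_2 uv)
      then show "\<exists>k l. x = k *s u + l *s v"
        by blast
    qed (auto simp: H_def uv)
    then show ?thesis
      by (auto simp: int_vec.span_breakdown_eq algebra_simps)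
  qed
  have basis: "columns_basis A H"
    by (simp add: columns_basis_def cols inj indep span)
  have rank: "has_rank H CARD(2)"
    unfolding has_rank_def by (rule exI[of _ "{u, v}"]) (simp add: indep span \<open>u \<noteq> v\<close>)
  interpret R: cring "int_power_ring :: (int ^ 2) ring"
    by (rule cring_int_power_ring)
  have inv: "inv\<^bsub>add_monoid int_power_ring\<^esub> x = - x" for x :: "int ^ 2"
    using R.minus_equality[of "- x" x] by (simp add: int_power_ring_simps a_inv_def)
  have sub: "subgroup H (add_monoid int_power_ring)"
  proof (rule subgroup.intro)
    show "inv\<^bsub>add_monoid int_power_ring\<^esub> x \<in> H" if "x \<in> H" for x
      unfolding inv using that by (simp add: H_def)
  qed (auto simp: H_def int_power_ring_simps)
  have ideal: "ideal H int_power_ring"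
    by (rule idealI[OF R.ring_axioms sub]) (auto simp: H_def int_power_ring_simps)
  have invariant: "(\<forall>r. even (B $ r $ 1 - B $ r $ 2)) \<and> (\<exists>r c. odd (B $ r $ c))"
    if "elementary_row_op\<^sup>*\<^sup>* A B" for B
    using that
  proof induction
    case base
    have "odd (A $ 1 $ 1)"
      by (simp add: A)
    then have "\<exists>r c. odd (A $ r $ c)"
      by blast
    then show ?case
      by (simp add: forall_2 A)
  next
    case (step B C)
    from step.hyps(2) step.IH show ?case
    proof cases
      case (swap i j)
      obtain r c where "odd (B $ r $ c)"
        using step.IH by blast
      then have "odd (C $ (if r = i then j else if r = j then i else r) $ c)"
        by (auto simp: swap)
      then have "\<exists>r c. odd (C $ r $ c)"
        by blast
      moreover have "\<forall>r. even (C $ r $ 1 - C $ r $ 2)"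
        using step.IH by (simp add: swap)
      ultimately show ?thesis
        by blast
    next
      case (scale c i)
      obtain r s where "odd (B $ r $ s)"
        using step.IH by blast
      then have "odd (C $ r $ s)"
        using scale by auto
      then have "\<exists>r c. odd (C $ r $ c)"
        by blast
      moreover have "\<forall>r. even (C $ r $ 1 - C $ r $ 2)"
        using step.IH scale by auto
      ultimately show ?thesis
        by blast
    next
      case (add i j c)
      obtain r s where rs: "odd (B $ r $ s)"
        using step.IH by blast
      have "\<exists>r s. odd (C $ r $ s)"
      proof (rule ccontr)
        assume *: "\<nexists>r s. odd (C $ r $ s)"
        have "even (C $ r $ s)" "even (C $ j $ s)"
          using * by blast+
        then show False
          using rs add by (auto split: if_splits)
      qed
      moreover have "even (C $ r $ 1 - C $ r $ 2)" for r
      proof (cases "r = i")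
        case True
        have "C $ i $ 1 - C $ i $ 2
            = (B $ i $ 1 - B $ i $ 2) + c * (B $ j $ 1 - B $ j $ 2)"
          by (simp add: add algebra_simps)
        moreover have "even (B $ i $ 1 - B $ i $ 2)" "even (B $ j $ 1 - B $ j $ 2)"
          using step.IH by blast+
        ultimately show ?thesis
          using True by (metis dvd_add dvd_mult)
      next
        case False
        then show ?thesis
          using step.IH by (simp add: add)
      qed
      ultimately show ?thesis
        by blast
    qed
  qed
  have "\<not> diagonal_matrix D" if "elementary_row_op\<^sup>*\<^sup>* A D" for D
  proof
    assume "diagonal_matrix D"
    then have "D $ 1 $ 2 = 0" "D $ 2 $ 1 = 0"
      by (simp_all add: diagonal_matrix_def)
    moreover from invariant[OF that] have "even (D $ 1 $ 1 - D $ 1 $ 2)" "even (D $ 2 $ 1 - D $ 2 $ 2)"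
      by blast+
    ultimately have "\<forall>r c. even (D $ r $ c)"
      by (simp add: forall_2)
    then show False
      using invariant[OF that] by blast
  qed
  then show ?thesis
    using additive_subgroup.intro[OF sub] rank basis ideal by blast
qed

end

theory Submission
  imports Defs
begin

text \<open>
  The implications are proved in the cycle (1) \<open>\<Longrightarrow>\<close> (3) \<open>\<Longrightarrow>\<close> (2) \<open>\<Longrightarrow>\<close> (1). Write \<open>B\<close> for
  \<open>transpose A\<close>, so that \<open>H\<close> is the set of integer combinations \<open>x v* B\<close> of the rows of \<open>B\<close>.

  Row operations are multiplications from the left by unimodular matrices. Hence they
  keep \<open>H\<close> and the independence of the rows, and a sequence that makes \<open>B\<close> diagonal gives, after
  transposition, a unimodular \<open>U\<close> with \<open>A ** U\<close> diagonal. If \<open>A ** U = D\<close> is diagonal, then \<open>H\<close> is the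
  image of \<open>D\<close>, and multiplication by an element of the ring commutes with \<open>D\<close>, so \<open>H\<close> is an
  ideal.

  The substance is in (1) \<open>\<Longrightarrow>\<close> (3). Call an index split off if its row and its column in \<open>B\<close> vanish
  away from a nonzero diagonal entry. As long as some row is not split off, it is nonzero by
  independence and so has a nonzero entry in some column \<open>c\<close>. Euclid's algorithm on the rows
  that are not split off makes column \<open>c\<close> vanish away from position \<open>(c, c)\<close>, where some \<open>d \<noteq> 0\<close>
  remains. Now the ideal property enters: the product of row \<open>c\<close> with the idempotent
  \<open>1 - axis c 1\<close> is in \<open>H\<close>. This product is row \<open>c\<close> without its entry \<open>d\<close>, and it is an integer
  combination of the rows. Since \<open>d\<close> and the diagonal entries already split off are nonzero and
  the product vanishes at these coordinates, the combination uses only rows which are neither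
  split off nor row \<open>c\<close> itself. Subtracting it from row \<open>c\<close> by row operations splits off \<open>c\<close>.
\<close>

section \<open>Row operations as unimodular factors\<close>

text \<open>
  The same operation applied to the identity matrix is the required factor, because row
  operations commute with multiplication from the right. The operation that undoes it
  provides the inverse of the factor.
\<close>

lemma row_operation_left_factor:
  fixes B B' :: "int ^ 'n ^ 'm" and f g :: "int ^ 'm ^ 'm \<Rightarrow> int ^ 'm ^ 'm"
  assumes "f (mat 1) ** B = B'"
    and f: "\<And>N. f (mat 1) ** N = f N" and g: "\<And>N. g (mat 1) ** N = g N"
    and fg: "\<And>N. f (g N) = N" and gf: "\<And>N. g (f N) = N"
  shows "\<exists>E :: int ^ 'm ^ 'm. invertible E \<and> B' = E ** B"
proof (intro exI conjI)
  show "invertible (f (mat 1))"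
    unfolding invertible_def using f g fg gf by metis
qed (simp add: assms(1))

lemma matrix_mult_row: "(N ** M) $ r = N $ r v* M"
  by (simp add: matrix_matrix_mult_def vector_matrix_mult_def vec_eq_iff)

lemma scaled_vector_matrix_mult: "(c *s x) v* (B :: int ^ 'n ^ 'm) = c *s (x v* B)"
  by (simp add: vector_matrix_mult_def vec_eq_iff sum_distrib_left mult.assoc)

lemma axis_vector_matrix_mult: "axis i 1 v* (B :: int ^ 'n ^ 'm) = B $ i"
  by (simp add: vector_matrix_mult_def axis_def vec_eq_iff if_distrib[of "\<lambda>c. c * _"] cong: if_cong)

lemma mat_1_row: "(mat 1 :: int ^ 'n ^ 'n) $ i = axis i 1"
  by (simp add: mat_def axis_def vec_eq_iff)

lemma elementary_row_op_left_factor: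
  fixes B B' :: "int ^ 'n ^ 'm"
  assumes "elementary_row_op B B'"
  shows "\<exists>E :: int ^ 'm ^ 'm. invertible E \<and> B' = E ** B"
  using assms
proof cases
  case (swap i j)
  show ?thesis
    by (rule row_operation_left_factor[where
          f = "\<lambda>N. \<chi> r. if r = i then N $ j else if r = j then N $ i else N $ r" and
          g = "\<lambda>N. \<chi> r. if r = i then N $ j else if r = j then N $ i else N $ r"])
      (auto simp: swap vec_eq_iff matrix_mult_row mat_1_row axis_vector_matrix_mult)
next
  case (scale c i)
  then have "c * c = 1"
    by auto
  then show ?thesis
    by (intro row_operation_left_factor[where
          f = "\<lambda>N. \<chi> r. if r = i then c *s (N $ i) else N $ r" and
          g = "\<lambda>N. \<chi> r. if r = i then c *s (N $ i) else N $ r"])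
      (auto simp: scale vec_eq_iff matrix_mult_row mat_1_row
        axis_vector_matrix_mult scaled_vector_matrix_mult)
next
  case (add i j c)
  then show ?thesis
    by (intro row_operation_left_factor[where
          f = "\<lambda>N. \<chi> r. if r = i then N $ i + c *s (N $ j) else N $ r" and
          g = "\<lambda>N. \<chi> r. if r = i then N $ i + (- c) *s (N $ j) else N $ r"])
      (auto simp: vec_eq_iff matrix_mult_row mat_1_row axis_vector_matrix_mult
        scaled_vector_matrix_mult vector_matrix_left_distrib vector_matrix_mult_diff_distrib
        simp flip: vector_sadd_rdistrib)
qed

lemma row_operations_left_factor:
  fixes B B' :: "int ^ 'n ^ 'm"
  assumes "elementary_row_op\<^sup>*\<^sup>* B B'"
  shows "\<exists>E :: int ^ 'm ^ 'm. invertible E \<and> B' = E ** B"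
  using assms
proof induction
  case base
  have "invertible (mat 1 :: int ^ 'm ^ 'm)"
    unfolding invertible_def using matrix_mul_lid by blast
  then show ?case
    by (metis matrix_mul_lid)
next
  case (step B' B'')
  then show ?case
    by (metis elementary_row_op_left_factor invertible_mult matrix_mul_assoc)
qed

lemma invertible_transpose_int:
  fixes E :: "int ^ 'n ^ 'n"
  assumes "invertible E"
  shows "invertible (transpose E)"
  using assms unfolding invertible_def by (metis matrix_transpose_mul transpose_mat)

definition row_lattice :: "int ^ 'n ^ 'm \<Rightarrow> (int ^ 'n) set"
  where "row_lattice B = range (\<lambda>x. x v* B)"

definition independent_rows :: "int ^ 'n ^ 'm \<Rightarrow> bool"
  where "independent_rows B \<longleftrightarrow> inj (\<lambda>x. x v* B)"

lemma row_operations_preserve: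
  assumes "elementary_row_op\<^sup>*\<^sup>* B B'"
  shows row_operations_row_lattice: "row_lattice B' = row_lattice B"
    and row_operations_independent_rows: "independent_rows B \<Longrightarrow> independent_rows B'"
proof -
  obtain E F where E: "B' = E ** B" "E ** F = mat 1" "F ** E = mat 1"
    using row_operations_left_factor[OF assms] unfolding invertible_def by blast
  have EF: "x v* E v* F = x" "x v* F v* E = x" for x
    by (simp_all add: vector_matrix_mul_assoc E)
  have B': "x v* B' = (x v* E) v* B" for x
    by (simp add: E vector_matrix_mul_assoc)
  have "surj (\<lambda>x. x v* E)"
    using EF by (metis surjI)
  then show "row_lattice B' = row_lattice B"
    unfolding row_lattice_def B' by (metis image_image[of "\<lambda>x. x v* B" "\<lambda>x. x v* E" UNIV])
  show "independent_rows B'" if "independent_rows B"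
    using that unfolding independent_rows_def inj_def B' by (metis EF(1))
qed

lemma row_in_row_lattice: "B $ r \<in> row_lattice B"
  unfolding row_lattice_def by (metis axis_vector_matrix_mult rangeI)

lemma independent_rows_nonzero:
  assumes "independent_rows B"
  shows "B $ r \<noteq> 0"
proof
  assume "B $ r = 0"
  then have "axis r 1 v* B = 0 v* B"
    by (simp add: axis_vector_matrix_mult)
  then have "axis r 1 = (0 :: int ^ _)"
    using assms unfolding independent_rows_def inj_def by blast
  then show False
    by simp
qed

section \<open>Splitting off one coordinate\<close>

text \<open>
  Euclid's algorithm on the entries of column \<open>c\<close> in the rows \<open>R\<close>: the sum of their absolute values
  decreases until at most one is nonzero, and a swap brings that one to row \<open>p\<close>. Only rows in \<open>R\<close> change, each into an integer combination of rows in \<open>R\<close>;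
  the last clause records the consequence that columns vanishing on \<open>R\<close> still do so.
\<close>

lemma row_operations_clear_column:
  fixes B :: "int ^ 'n ^ 'm"
  assumes "p \<in> R"
  shows "\<exists>B'. elementary_row_op\<^sup>*\<^sup>* B B' \<and> (\<forall>r. r \<notin> R \<longrightarrow> B' $ r = B $ r) \<and>
    (\<forall>r \<in> R - {p}. B' $ r $ c = 0) \<and>
    (\<forall>j. (\<forall>r \<in> R. B $ r $ j = 0) \<longrightarrow> (\<forall>r \<in> R. B' $ r $ j = 0))"
proof (induction "nat (\<Sum>r \<in> R. \<bar>B $ r $ c\<bar>)" arbitrary: B rule: less_induct)
  case less
  show ?case
  proof (cases "\<exists>r \<in> R. \<exists>s \<in> R. r \<noteq> s \<and> B $ s $ c \<noteq> 0 \<and> \<bar>B $ s $ c\<bar> \<le> \<bar>B $ r $ c\<bar>")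
    case True
    then obtain r s where rs: "r \<in> R" "s \<in> R" "r \<noteq> s" "B $ s $ c \<noteq> 0" "\<bar>B $ s $ c\<bar> \<le> \<bar>B $ r $ c\<bar>"
      by blast
    (* With this sign the new entry in row r has absolute value |B r c| - |B s c|. *)
    define q where "q = - sgn (B $ r $ c) * sgn (B $ s $ c)"
    define C where "C = (\<chi> k. if k = r then B $ r + q *s (B $ s) else B $ k)"
    have op: "elementary_row_op B C"
      unfolding C_def using rs(3) by (rule elementary_row_op.add)
    have smaller: "\<bar>C $ r $ c\<bar> < \<bar>B $ r $ c\<bar>"
      using rs(4,5) by (auto simp: C_def q_def sgn_if split: if_splits)
    have "(\<Sum>k \<in> R. \<bar>C $ k $ c\<bar>) < (\<Sum>k \<in> R. \<bar>B $ k $ c\<bar>)"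
      using rs(1) smaller by (intro sum_strict_mono_ex1) (auto simp: C_def)
    moreover have "0 \<le> (\<Sum>k \<in> R. \<bar>C $ k $ c\<bar>)"
      by (simp add: sum_nonneg)
    ultimately have "nat (\<Sum>k \<in> R. \<bar>C $ k $ c\<bar>) < nat (\<Sum>k \<in> R. \<bar>B $ k $ c\<bar>)"
      by linarith
    from less.hyps[OF this] obtain B' where B': "elementary_row_op\<^sup>*\<^sup>* C B'"
      "\<forall>k. k \<notin> R \<longrightarrow> B' $ k = C $ k" "\<forall>k \<in> R - {p}. B' $ k $ c = 0"
      "\<forall>j. (\<forall>k \<in> R. C $ k $ j = 0) \<longrightarrow> (\<forall>k \<in> R. B' $ k $ j = 0)"
      by blast
    have "\<forall>k. k \<notin> R \<longrightarrow> B' $ k = B $ k"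
      using B'(2) rs(1) by (auto simp: C_def)
    moreover have "\<forall>k \<in> R. C $ k $ j = 0" if "\<forall>k \<in> R. B $ k $ j = 0" for j
      using that rs(1,2) by (auto simp: C_def)
    then have "\<forall>j. (\<forall>k \<in> R. B $ k $ j = 0) \<longrightarrow> (\<forall>k \<in> R. B' $ k $ j = 0)"
      using B'(4) by blast
    moreover have "elementary_row_op\<^sup>*\<^sup>* B B'"
      using op B'(1) by (rule converse_rtranclp_into_rtranclp)
    ultimately show ?thesis
      using B'(3) by blast
  next
    case stuck: False
    show ?thesis
    proof (cases "\<forall>r \<in> R - {p}. B $ r $ c = 0")
      case True
      then show ?thesis
        by blast
    next
      case False
      then obtain q where q: "q \<in> R" "q \<noteq> p" "B $ q $ c \<noteq> 0"
        by blast
      (* Of two nonzero entries one would be at most the other in absolute value. *)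
      have rest: "B $ r $ c = 0" if "r \<in> R" "r \<noteq> q" for r
        using stuck that q by (metis linear)
      define C where "C = (\<chi> k. if k = p then B $ q else if k = q then B $ p else B $ k)"
      have "elementary_row_op B C"
        unfolding C_def by (rule elementary_row_op.swap)
      moreover have "\<forall>r. r \<notin> R \<longrightarrow> C $ r = B $ r" "\<forall>r \<in> R - {p}. C $ r $ c = 0"
        "\<forall>j. (\<forall>r \<in> R. B $ r $ j = 0) \<longrightarrow> (\<forall>r \<in> R. C $ r $ j = 0)"
        using assms q rest by (auto simp: C_def)
      ultimately show ?thesis
        by blast
    qed
  qed
qed

text \<open>Since \<open>i \<notin> T\<close>, the rows that are added stay unchanged while row \<open>i\<close> accumulates them one by one.\<close>

lemma row_operations_add_combination:
  fixes B :: "int ^ 'n ^ 'm"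
  assumes "finite T" "i \<notin> T"
  shows "elementary_row_op\<^sup>*\<^sup>* B (\<chi> r. if r = i then B $ i + (\<Sum>t \<in> T. x t *s (B $ t)) else B $ r)"
  using assms
proof (induction T)
  case empty
  have "(\<chi> r. if r = i then B $ i + (\<Sum>t \<in> {}. x t *s (B $ t)) else B $ r) = B"
    by (simp add: vec_eq_iff)
  then show ?case
    by (metis rtranclp.rtrancl_refl)
next
  case (insert s T)
  let ?C = "\<chi> r. if r = i then B $ i + (\<Sum>t \<in> T. x t *s (B $ t)) else B $ r"
  have "elementary_row_op ?C (\<chi> r. if r = i then ?C $ i + x s *s (?C $ s) else ?C $ r)"
    using insert by (intro elementary_row_op.add) auto
  also have "(\<chi> r. if r = i then ?C $ i + x s *s (?C $ s) else ?C $ r)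
      = (\<chi> r. if r = i then B $ i + (\<Sum>t \<in> insert s T. x t *s (B $ t)) else B $ r)"
    using insert by (auto simp: vec_eq_iff algebra_simps)
  finally show ?case
    using insert by (simp add: rtranclp.rtrancl_into_rtrancl)
qed

definition split_off :: "'k set \<Rightarrow> int ^ 'k ^ 'k \<Rightarrow> bool"
  where "split_off S B \<longleftrightarrow>
    (\<forall>i \<in> S. B $ i $ i \<noteq> 0 \<and> (\<forall>j. j \<noteq> i \<longrightarrow> B $ i $ j = 0 \<and> B $ j $ i = 0))"

lemma vector_matrix_mult_rows: "x v* (B :: int ^ 'n ^ 'm) = (\<Sum>r \<in> UNIV. x $ r *s (B $ r))"
  by (simp add: vector_matrix_mult_def vec_eq_iff)

text \<open>
  A combination of the rows with coordinate \<open>0\<close> in a column that has a single nonzero entry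
  does not use the row of that entry.
\<close>

lemma coefficient_zero:
  fixes B :: "int ^ 'n ^ 'm"
  assumes "(x v* B) $ j = 0" "B $ i $ j \<noteq> 0" "\<And>r. r \<noteq> i \<Longrightarrow> B $ r $ j = 0"
  shows "x $ i = 0"
proof -
  have "(x v* B) $ j = (\<Sum>r \<in> UNIV. if r = i then x $ i * B $ i $ j else 0)"
    unfolding vector_matrix_mult_def vec_lambda_beta
    using assms(3) by (intro sum.cong) auto
  then show ?thesis
    using assms(1,2) by simp
qed

text \<open>
  The step of the induction. The new index \<open>c\<close> is dictated by a nonzero entry of some row that
  is not split off. This entry guarantees that the pivot left by Euclid's algorithm is nonzero,
  because the entries of column \<open>c\<close> have the same integer combinations before and after.
\<close>

lemma row_operations_split_off_next:
  fixes B :: "int ^ 'k ^ 'k"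
  assumes split: "split_off S B" and "S \<noteq> UNIV" and "independent_rows B"
    and closed: "\<And>h r. h \<in> row_lattice B \<Longrightarrow> r * h \<in> row_lattice B"
  shows "\<exists>c B'. c \<notin> S \<and> elementary_row_op\<^sup>*\<^sup>* B B' \<and> split_off (insert c S) B'"
proof -
  obtain p where "p \<notin> S"
    using \<open>S \<noteq> UNIV\<close> by blast
  obtain c where c: "B $ p $ c \<noteq> 0"
    using independent_rows_nonzero[OF \<open>independent_rows B\<close>, of p] by (auto simp: vec_eq_iff)
  have "c \<notin> S"
    using split c \<open>p \<notin> S\<close> unfolding split_off_def by metis
  then obtain C where C: "elementary_row_op\<^sup>*\<^sup>* B C" "\<And>r. r \<in> S \<Longrightarrow> C $ r = B $ r"
    "\<And>r. r \<notin> S \<Longrightarrow> r \<noteq> c \<Longrightarrow> C $ r $ c = 0"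
    "\<And>j r. (\<And>s. s \<notin> S \<Longrightarrow> B $ s $ j = 0) \<Longrightarrow> r \<notin> S \<Longrightarrow> C $ r $ j = 0"
    using row_operations_clear_column[of c "- S" B c] by (auto 0 3)
  have lattice: "row_lattice C = row_lattice B"
    by (rule row_operations_row_lattice[OF C(1)])
  have splitC: "split_off S C"
    unfolding split_off_def
  proof (intro ballI conjI allI impI)
    fix i j assume i: "i \<in> S" and j: "j \<noteq> i"
    show "C $ i $ j = 0"
      using split i j by (simp add: C(2) split_off_def)
    show "C $ j $ i = 0"
    proof (cases "j \<in> S")
      case True
      then show ?thesis
        using split i j by (simp add: C(2) split_off_def)
    next
      case False
      have "B $ s $ i = 0" if "s \<notin> S" for s
        using split i that unfolding split_off_def by metis
      then show ?thesis
        using False C(4) by blast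
    qed
  qed (use split C(2) in \<open>auto simp: split_off_def\<close>)
  have column: "C $ r $ c = 0" if "r \<noteq> c" for r
    using splitC \<open>c \<notin> S\<close> C(3)[of r] that unfolding split_off_def by metis
  define d where "d = C $ c $ c"
  have "d \<noteq> 0"
  proof
    assume "d = 0"
    then have "C $ r $ c = 0" for r
      using column by (cases "r = c") (auto simp: d_def)
    then have "(x v* C) $ c = 0" for x
      by (simp add: vector_matrix_mult_def)
    moreover have "B $ p \<in> row_lattice C"
      by (simp add: lattice row_in_row_lattice)
    ultimately show False
      using c unfolding row_lattice_def by auto
  qed
  (* Multiplying row c by 1 - axis c 1 removes its entry d; the other entries have to go. *)
  have "(1 - axis c 1) * C $ c \<in> row_lattice C"
    using closed row_in_row_lattice[of C c] by (simp add: lattice)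
  then obtain x where x: "(1 - axis c 1) * C $ c = x v* C"
    unfolding row_lattice_def by blast
  have "x $ c = 0"
  proof (rule coefficient_zero)
    show "(x v* C) $ c = 0"
      by (simp flip: x)
  qed (use column \<open>d \<noteq> 0\<close> in \<open>auto simp: d_def\<close>)
  have xS: "x $ i = 0" if "i \<in> S" for i
  proof (rule coefficient_zero)
    have "C $ c $ i = 0"
      using splitC that \<open>c \<notin> S\<close> unfolding split_off_def by metis
    then show "(x v* C) $ i = 0"
      by (simp flip: x)
  qed (use splitC that in \<open>auto simp: split_off_def\<close>)
  define D where "D = (\<chi> r. if r = c then C $ c + (\<Sum>t \<in> - {c}. (- x $ t) *s (C $ t)) else C $ r)"
  have "elementary_row_op\<^sup>*\<^sup>* C D"
    unfolding D_def by (rule row_operations_add_combination) auto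
  moreover have "split_off (insert c S) D"
  proof -
    have "x v* C = (\<Sum>t \<in> - {c}. x $ t *s (C $ t))"
      unfolding vector_matrix_mult_rows using \<open>x $ c = 0\<close>
      by (intro sum.mono_neutral_right) auto
    then have "D $ c = C $ c - (1 - axis c 1) * C $ c"
      unfolding x by (simp add: D_def sum_negf)
    then have Dc: "D $ c $ j = (if j = c then d else 0)" for j
      by (simp add: axis_def d_def)
    have Dr: "D $ r = C $ r" if "r \<noteq> c" for r
      using that by (simp add: D_def)
    show ?thesis
      unfolding split_off_def
    proof (intro ballI conjI allI impI)
      fix i assume i: "i \<in> insert c S"
      show "D $ i $ i \<noteq> 0"
        using i splitC \<open>d \<noteq> 0\<close> by (cases "i = c") (auto simp: Dc Dr split_off_def)
      fix j assume j: "j \<noteq> i"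
      show "D $ i $ j = 0"
        using i j splitC by (cases "i = c") (auto simp: Dc Dr split_off_def)
      show "D $ j $ i = 0"
        using i j splitC column by (cases "j = c"; cases "i = c") (auto simp: Dc Dr split_off_def)
    qed
  qed
  ultimately show ?thesis
    using \<open>c \<notin> S\<close> C(1) by (meson rtranclp_trans)
qed

lemma row_operations_diagonalize_ideal:
  fixes B :: "int ^ 'k ^ 'k"
  assumes "independent_rows B"
    and "\<And>h r. h \<in> row_lattice B \<Longrightarrow> r * h \<in> row_lattice B"
  shows "\<exists>D. elementary_row_op\<^sup>*\<^sup>* B D \<and> diagonal_matrix D"
proof -
  have "\<exists>D. elementary_row_op\<^sup>*\<^sup>* B D \<and> diagonal_matrix D"
    if "split_off S B" "independent_rows B"
      "\<And>h r. h \<in> row_lattice B \<Longrightarrow> r * h \<in> row_lattice B"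
    for S and B :: "int ^ 'k ^ 'k"
    using that
  proof (induction "card (- S)" arbitrary: S B rule: less_induct)
    case less
    show ?case
    proof (cases "S = UNIV")
      case True
      then have "diagonal_matrix B"
        using less.prems(1) by (simp add: diagonal_matrix_def split_off_def)
      then show ?thesis
        by blast
    next
      case False
      then obtain c B' where B': "c \<notin> S" "elementary_row_op\<^sup>*\<^sup>* B B'" "split_off (insert c S) B'"
        using row_operations_split_off_next less.prems by meson
      have "card (- insert c S) < card (- S)"
        using B'(1) by (intro psubset_card_mono) auto
      then have "\<exists>D. elementary_row_op\<^sup>*\<^sup>* B' D \<and> diagonal_matrix D"
        using less.hyps B' less.prems row_operations_preserve[OF B'(2)] by metis
      then show ?thesis
        using B'(2) by (meson rtranclp_trans)
    qed
  qed
  then show ?thesis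
    using assms by (meson empty_iff split_off_def)
qed

section \<open>The equivalence\<close>

text \<open>
  A coefficient function on the set of columns is the same as a coefficient vector on the
  column indices, because distinct indices have distinct columns.
\<close>

lemma columns_basis_transpose:
  fixes A :: "int ^ 'm ^ 'k"
  assumes "columns_basis A H"
  shows "row_lattice (transpose A) = H" and "independent_rows (transpose A)"
proof -
  have inj: "inj (\<lambda>j. column j A)" and indep: "int_vec.independent (columns A)"
    and span: "int_vec.span (columns A) = H"
    using assms by (auto simp: columns_basis_def)
  have cols: "columns A = range (\<lambda>j. column j A)"
    by (auto simp: columns_def)
  have comb: "(\<Sum>v \<in> columns A. u v *s v) = (\<chi> j. u (column j A)) v* transpose A" for u
    unfolding cols by (simp add: sum.reindex[OF inj] matrix_mult_sum)
  have coeffs: "\<exists>u. x = (\<chi> j. u (column j A))" for x :: "int ^ 'm"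
    by (rule exI[of _ "\<lambda>v. x $ inv_into UNIV (\<lambda>j. column j A) v"]) (simp add: vec_eq_iff inv_f_f[OF inj])
  then have surj: "surj (\<lambda>u. (\<chi> j. u (column j A)) :: int ^ 'm)"
    unfolding surj_def by blast
  have "H = range (\<lambda>u. (\<chi> j. u (column j A)) v* transpose A)"
    unfolding span[symmetric] comb[symmetric]
    by (rule int_vec.span_finite) (simp add: cols)
  also have "\<dots> = (\<lambda>x. x v* transpose A) ` range (\<lambda>u. \<chi> j. u (column j A))"
    unfolding image_image ..
  finally show "row_lattice (transpose A) = H"
    unfolding row_lattice_def surj ..
  have zero: "x = 0" if "x v* transpose A = 0" for x
  proof -
    obtain u where u: "x = (\<chi> j. u (column j A))"
      using coeffs by blast
    then have "(\<Sum>v \<in> columns A. u v *s v) = 0"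
      using that comb by simp
    moreover have "finite (columns A)"
      by (simp add: cols)
    ultimately have "\<forall>v \<in> columns A. u v = 0"
      using indep int_vec.dependent_finite by blast
    then show "x = 0"
      by (simp add: u vec_eq_iff cols)
  qed
  show "independent_rows (transpose A)"
    unfolding independent_rows_def inj_def
    by (metis zero vector_matrix_mult_diff_distrib right_minus_eq)
qed

lemma ideal_int_power_ring_iff:
  assumes "additive_subgroup H int_power_ring"
  shows "ideal H int_power_ring \<longleftrightarrow> (\<forall>h \<in> H. \<forall>r. r * h \<in> H)"
proof
  assume "ideal H int_power_ring"
  then show "\<forall>h \<in> H. \<forall>r. r * h \<in> H"
    using ideal.I_l_closed by (fastforce simp: int_power_ring_simps)
next
  assume closed: "\<forall>h \<in> H. \<forall>r. r * h \<in> H"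
  have "ring (int_power_ring :: (int ^ 'a) ring)"
    using cring_int_power_ring by (rule cring.axioms)
  then show "ideal H int_power_ring"
    using additive_subgroup.a_subgroup[OF assms] closed
    by (intro idealI) (auto simp: int_power_ring_simps mult.commute)
qed

lemma diagonal_matrix_transpose: "diagonal_matrix D \<Longrightarrow> diagonal_matrix (transpose D)"
  by (auto simp: diagonal_matrix_def transpose_def)

text \<open>This is why the image of a diagonal matrix is an ideal.\<close>

lemma diagonal_matrix_mult_commute:
  assumes "diagonal_matrix D"
  shows "r * (D *v y) = D *v (r * y)"
proof -
  have "r $ i * (D $ i $ j * y $ j) = D $ i $ j * (r $ j * y $ j)" for i j
    using assms by (cases "i = j") (auto simp: diagonal_matrix_def)
  then show ?thesis
    unfolding vec_eq_iff matrix_vector_mult_def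
    by (simp only: vec_lambda_beta vector_mult_component sum_distrib_left simp_thms)
qed

theorem theorem3p6:
  fixes H :: "(int ^ 'k) set" and A :: "int ^ 'k ^ 'k"
  assumes "additive_subgroup H int_power_ring"
    and "has_rank H CARD('k)"
    and "columns_basis A H"
  shows "(ideal H int_power_ring \<longleftrightarrow>
           (\<exists>U :: int ^ 'k ^ 'k. invertible U \<and> diagonal_matrix (A ** U))) \<and>
         ((\<exists>U :: int ^ 'k ^ 'k. invertible U \<and> diagonal_matrix (A ** U)) \<longleftrightarrow>
           (\<exists>D. elementary_row_op\<^sup>*\<^sup>* (transpose A) D \<and> diagonal_matrix D))"
    (is "(?ideal \<longleftrightarrow> ?unimodular) \<and> (_ \<longleftrightarrow> ?row_ops)")
proof -
  note lattice = columns_basis_transpose(1)[OF assms(3)]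
  have "?row_ops" if "?ideal"
    using row_operations_diagonalize_ideal[OF columns_basis_transpose(2)[OF assms(3)]] that
    unfolding lattice ideal_int_power_ring_iff[OF assms(1)] by blast
  moreover have "?unimodular" if row_ops: "?row_ops"
  proof -
    obtain D where D: "elementary_row_op\<^sup>*\<^sup>* (transpose A) D" "diagonal_matrix D"
      using row_ops by blast
    obtain E :: "int ^ 'k ^ 'k" where E: "invertible E" "D = E ** transpose A"
      using row_operations_left_factor[OF D(1)] by blast
    have "transpose D = A ** transpose E"
      by (simp add: E(2) matrix_transpose_mul)
    then show ?thesis
      using diagonal_matrix_transpose[OF D(2)] invertible_transpose_int[OF E(1)] by metis
  qed
  moreover have "?ideal" if unimodular: "?unimodular"
  proof -
    obtain U V :: "int ^ 'k ^ 'k" where diag: "diagonal_matrix (A ** U)" and UV: "U ** V = mat 1"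
      using unimodular unfolding invertible_def by blast
    have "r * h \<in> H" if h: "h \<in> H" for h r
    proof -
      obtain x where "h = A *v x"
        using h unfolding lattice[symmetric] row_lattice_def by auto
      also have "A *v x = (A ** U) *v (V *v x)"
        by (metis UV matrix_mul_assoc matrix_mul_rid matrix_vector_mul_assoc)
      finally have "r * h = (A ** U) *v (r * (V *v x))"
        by (simp only: diagonal_matrix_mult_commute[OF diag])
      then have "r * h = A *v (U *v (r * (V *v x)))"
        by (simp only: matrix_vector_mul_assoc)
      then show ?thesis
        unfolding lattice[symmetric] row_lattice_def by auto
    qed
    then show ?thesis
      by (simp add: ideal_int_power_ring_iff[OF assms(1)])
  qed
  ultimately show ?thesis
    by blast
qed

end
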